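(* Let $p$ be a prime, let $n=cp^h$ with $c\ge 1$ and $h\ge 0$ integers, where $c=\sum_{i\ge 0}c_ip^i$ is the base $p$ expansion of $c$. Let $k$ be an integer and let $k'$ be the least positive residue of $k$ modulo $p-1$ (so $1\le k'\le p-1$ and $k\equiv k' \pmod{p-1}$). Assume that $0<k\le \min\{c_0,k'\}\,p^h$. (a) If $\sigma_p(n)\ge k'$ and $n'$ is the smallest bottom segment of the base $p$ expansion of $n$ with $\sigma_p(n')=k'$, then the maximum pole of $B_{n-k}^{(-k)}(x)$ equals $\sigma_p(n'-k)/(p-1)$, and the almost minimum zero estimate for $S(n,k)$ is $$\nu_p(S(n,k))\ge \frac{\sigma_p(k)-k'}{p-1}.$$ (b) If $n\equiv k\pmod{p-1}$, then $S(n,k)$ is an almost minimum zero case (AMZC) and $$\nu_p(S(n,k))=\frac{\sigma_p(k)-k'}{p-1}.$$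
   Context: $S(n,k)$ is the Stirling number of the second kind; $\sigma_p(m)$ is the sum of the base $p$ digits of $m\ge 0$; $\nu_p$ is the $p$-adic valuation. Higher order Bernoulli polynomials $B_m^{(l)}(x)$ ($m\ge 0$, $l\in\mathbb Z$) are defined by $\left(\frac{t}{e^t-1}\right)^l e^{tx}=\sum_{m\ge 0}B_m^{(l)}(x)\frac{t^m}{m!}$; $B_m^{(l)}(x)$ is monic of degree $m$ with rational coefficients, and $B_m^{(l)}=B_m^{(l)}(0)$. The maximum pole (with respect to $p$) of a nonzero rational polynomial $f$ is the integer $M$ with $-M=\min_i \nu_p(a_i)$ over its coefficients $a_i$. For $n\ge k\ge 1$ one has $S(n,k)=\binom nk B_{n-k}^{(-k)}$. With $M$ the maximum pole of $B_{n-k}^{(-k)}(x)$, the almost minimum zero (AMZ) estimate is $\nu_p(S(n,k))\ge \nu_p\left(\binom nk\right)-M$; saying that the AMZ estimate is $\nu_p(S(n,k))\ge E$ means $E=\nu_p\left(\binom nk\right)-M$. $S(n,k)$ is an almost minimum zero case (AMZC) if this estimate is sharp, i.e. $\nu_p(S(n,k))=\nu_p\left(\binom nk\right)-M$ (equivalently $\nu_p(B_{n-k}^{(-k)})=-M$). If $n=\sum_i n_ip^i$ is the base $p$ expansion, a bottom segment of $n$ is a number of the form $\sum_{i<j}n_ip^i+m p^j$ with $j\ge 0$ and $0\le m\le n_j$. *)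

theory Defs
  imports
    Complex_Main
    "HOL-Combinatorics.Stirling"
    "HOL-Computational_Algebra.Computational_Algebra"
    "HOL-Number_Theory.Cong"
begin

definition digit :: "nat \<Rightarrow> nat \<Rightarrow> nat \<Rightarrow> nat" where
  "digit p m i = m div p ^ i mod p"

definition digit_sum :: "nat \<Rightarrow> nat \<Rightarrow> nat" where
  "digit_sum p m = (\<Sum>i | digit p m i \<noteq> 0. digit p m i)"

definition bottom_segment :: "nat \<Rightarrow> nat \<Rightarrow> nat \<Rightarrow> bool" where
  "bottom_segment p n s \<longleftrightarrow>
     (\<exists>j m. m \<le> digit p n j \<and> s = (\<Sum>i<j. digit p n i * p ^ i) + m * p ^ j)"

(* Meaningful for nonzero arguments only: the valuation of 0 is infinite, but
   this function returns 0 there. *)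
definition rat_valuation :: "nat \<Rightarrow> rat \<Rightarrow> int" where
  "rat_valuation p q =
     int (multiplicity (int p) (fst (quotient_of q))) -
     int (multiplicity (int p) (snd (quotient_of q)))"

(* The coefficient of t^m / m! in (t / (exp t - 1))^l * exp (x t), computed in the
   ring of power series in t over the polynomials in x: the first factor, a power
   series over the rationals, is embedded coefficientwise as constant polynomials,
   and the coefficient of t^i in exp (x t) is x^i / i!.  As t / (exp t - 1) has
   constant coefficient 1, its negative integer powers are genuine. *)
definition bernoulli_poly_ho :: "int \<Rightarrow> nat \<Rightarrow> rat poly" where
  "bernoulli_poly_ho l m =
     smult (fact m)
       (fps_nth
         (Abs_fps (\<lambda>i. [:fps_nth ((fps_X / (fps_exp 1 - 1)) powi l) i:]) *
          Abs_fps (\<lambda>i. monom (1 / fact i) i))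
         m)"

(* Zero coefficients have infinite valuation, so they do not enter the minimum. *)
definition maximum_pole :: "nat \<Rightarrow> rat poly \<Rightarrow> int" where
  "maximum_pole p f = - Min ((\<lambda>i. rat_valuation p (coeff f i)) ` {i. coeff f i \<noteq> 0})"

(* The right-hand side E of the almost minimum zero estimate nu_p (S(n,k)) >= E. *)
definition amz_estimate :: "nat \<Rightarrow> nat \<Rightarrow> nat \<Rightarrow> int" where
  "amz_estimate p n k =
     int (multiplicity p (n choose k)) - maximum_pole p (bernoulli_poly_ho (- int k) (n - k))"

definition AMZC :: "nat \<Rightarrow> nat \<Rightarrow> nat \<Rightarrow> bool" where
  "AMZC p n k \<longleftrightarrow> int (multiplicity p (Stirling n k)) = amz_estimate p n k"

end

(* The coefficient of x^r in B_{n-k}^{(-k)}(x) is C(n,j) S(j,k) / C(n,k) with j = n - r, so the AMZ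
   estimate is the minimum of nu_p (C(n,j) S(j,k)) over k <= j <= n.  As k! S(j,k) is the k-th
   forward difference of x^j at 0, and (p - 1) nu_p (k!) = k - sigma_p(k), it suffices to show, with
   N = (k - k') / (p - 1), that p^N divides C(n,j) k! S(j,k) for all j, and that nu_p (k! S(n,k)) = N
   if n = k mod p - 1; a bottom segment n' satisfies the latter condition and gives the minimum
   because C(n,n') is prime to p.
   For both claims x^j is expanded, on each residue class i mod p, in binomial functions of
   (x - i) / p.  Their differences have large valuation because (E^p - 1) lowers the degree in
   (x - i) / p while E^p - 1 = Delta^p modulo p Delta; the coefficients of positive degree are
   divisible by a high power of p because p^h divides n.  What remains is the p-periodic function
   (x mod p)^n, whose differences satisfy Delta^(k+p-1) = -p Delta^k to leading order. *)

theory Submission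
  imports Defs
begin

section \<open>Forward differences\<close>

definition fwd_diff :: "(nat \<Rightarrow> int) \<Rightarrow> nat \<Rightarrow> int" where
  "fwd_diff f x = f (Suc x) - f x"

lemma funpow_fwd_diff_Suc:
  "(fwd_diff ^^ Suc k) f x = (fwd_diff ^^ k) f (Suc x) - (fwd_diff ^^ k) f x"
  by (simp add: fwd_diff_def)

lemma funpow_fwd_diff_Suc':
  "(fwd_diff ^^ Suc k) f = (fwd_diff ^^ k) (fwd_diff f)"
  by (simp only: funpow_Suc_right o_apply)

text \<open>\<open>k\<close> differences at \<open>x\<close> see only the values at
  \<open>x\<close>, ..., \<open>x + k\<close>. This finite window allows \<open>f\<close> to be
  replaced by a formula that is valid for small arguments only.\<close>

lemma funpow_fwd_diff_cong:
  assumes "\<And>y. y \<le> k \<Longrightarrow> f (x + y) = g (x + y)"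
  shows "(fwd_diff ^^ k) f x = (fwd_diff ^^ k) g x"
  using assms
proof (induction k arbitrary: x)
  case 0
  show ?case using 0[of 0] by simp
next
  case (Suc k)
  have "(fwd_diff ^^ k) f (Suc x) = (fwd_diff ^^ k) g (Suc x)"
    by (rule Suc.IH) (use Suc.prems[of "Suc _"] in simp)
  moreover have "(fwd_diff ^^ k) f x = (fwd_diff ^^ k) g x"
    by (rule Suc.IH) (use Suc.prems in simp)
  ultimately show ?case by (simp only: funpow_fwd_diff_Suc)
qed

lemma funpow_fwd_diff_zero: "(fwd_diff ^^ k) (\<lambda>_. 0) x = 0"
  by (induction k arbitrary: x) (simp_all add: fwd_diff_def)

lemma funpow_fwd_diff_add:
  "(fwd_diff ^^ k) (\<lambda>x. f x + g x) x = (fwd_diff ^^ k) f x + (fwd_diff ^^ k) g x"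
  by (induction k arbitrary: x) (simp_all add: fwd_diff_def)

lemma funpow_fwd_diff_sum:
  "(fwd_diff ^^ k) (\<lambda>x. \<Sum>a\<in>A. c a * F a x) x = (\<Sum>a\<in>A. c a * (fwd_diff ^^ k) (F a) x)"
  by (induction k arbitrary: x)
    (simp_all add: fwd_diff_def sum_subtractf right_diff_distrib)

lemma funpow_fwd_diff_shift:
  "(fwd_diff ^^ k) (\<lambda>x. f (x + d)) x = (fwd_diff ^^ k) f (x + d)"
  by (induction k arbitrary: x) (simp_all add: fwd_diff_def)

lemma funpow_fwd_diff_dvd:
  assumes "\<And>y. d dvd f y"
  shows "d dvd (fwd_diff ^^ k) f x"
  using assms by (induction k arbitrary: x) (simp_all add: fwd_diff_def)

text \<open>With E = 1 + Delta for the unit shift E, this is the binomial theorem for E^d. The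
  induction keeps \<open>f\<close> arbitrary because one more shift needs the formula both for
  \<open>f\<close> and for \<open>fwd_diff f\<close>.\<close>

lemma newton_forward:
  "f (x + d) = (\<Sum>t\<le>d. int (d choose t) * (fwd_diff ^^ t) f x)"
proof (induction d arbitrary: f)
  case 0
  show ?case by simp
next
  case (Suc d)
  let ?D = "\<lambda>t. (fwd_diff ^^ t) f x"
  have "f (x + Suc d) = f (x + d) + fwd_diff f (x + d)"
    by (simp add: fwd_diff_def)
  also have "\<dots> = (\<Sum>t\<le>d. int (d choose t) * ?D t) + (\<Sum>t\<le>d. int (d choose t) * ?D (Suc t))"
    unfolding Suc[of f] Suc[of "fwd_diff f"] by (simp only: funpow_fwd_diff_Suc')
  \<comment> \<open>The added term is zero. With the longer range, splitting off t = 0 lets the two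
    sums combine by Pascal's rule.\<close>
  also have "(\<Sum>t\<le>d. int (d choose t) * ?D t) = (\<Sum>t\<le>Suc d. int (d choose t) * ?D t)"
    by (simp add: binomial_eq_0)
  also have "\<dots> = ?D 0 + (\<Sum>t\<le>d. int (d choose Suc t) * ?D (Suc t))"
    by (subst sum.atMost_Suc_shift) simp
  also have "\<dots> + (\<Sum>t\<le>d. int (d choose t) * ?D (Suc t)) =
      ?D 0 + (\<Sum>t\<le>d. int (Suc d choose Suc t) * ?D (Suc t))"
    by (simp add: sum.distrib algebra_simps del: funpow.simps)
  also have "\<dots> = (\<Sum>t\<le>Suc d. int (Suc d choose t) * ?D t)"
    by (subst sum.atMost_Suc_shift) simp
  finally show ?case .
qed

lemma newton_forward_diff:
  "(fwd_diff ^^ k) f (x + d) = (\<Sum>t\<le>d. int (d choose t) * (fwd_diff ^^ (k + t)) f x)"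
  using newton_forward[of "(fwd_diff ^^ k) f" x d]
  by (simp add: funpow_add add.commute[of k])

text \<open>The Leibniz rule for multiplication by x. At 0 and for f = x^n it is the Stirling
  recurrence times (k + 1)!.\<close>

lemma funpow_fwd_diff_mult_id:
  "(fwd_diff ^^ Suc k) (\<lambda>x. int x * f x) x =
     int (x + Suc k) * (fwd_diff ^^ Suc k) f x + int (Suc k) * (fwd_diff ^^ k) f x"
proof (induction k arbitrary: x)
  case 0
  show ?case by (simp add: fwd_diff_def algebra_simps)
next
  case (Suc k)
  have shift: "(fwd_diff ^^ j) f (Suc x) = (fwd_diff ^^ j) f x + (fwd_diff ^^ Suc j) f x" for j
    by (simp add: funpow_fwd_diff_Suc del: funpow.simps)
  show ?case
    unfolding funpow_fwd_diff_Suc[of "Suc k" "\<lambda>x. int x * f x"] Suc shift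
    by (simp add: algebra_simps del: funpow.simps)
qed

lemma funpow_fwd_diff_power:
  "(fwd_diff ^^ k) (\<lambda>x. int x ^ n) 0 = fact k * int (Stirling n k)"
proof (induction n arbitrary: k)
  case 0
  have "fwd_diff (\<lambda>_. 1) = (\<lambda>_. 0)"
    by (simp add: fwd_diff_def fun_eq_iff)
  then show ?case
    by (cases k) (simp_all add: funpow_fwd_diff_Suc' funpow_fwd_diff_zero del: funpow.simps)
next
  case (Suc n)
  show ?case
  proof (cases k)
    case 0
    then show ?thesis by simp
  next
    case (Suc j)
    then show ?thesis
      using funpow_fwd_diff_mult_id[of j "\<lambda>x. int x ^ n" 0] Suc.IH
      by (simp add: algebra_simps del: funpow.simps)
  qed
qed

text \<open>In the expansion by powers of y, the term y^j carries p^j and has s-th difference s!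
  S(j,s) at 0, which vanishes for j < s.\<close>

lemma funpow_fwd_diff_arith_power_dvd:
  "int p ^ s * fact s dvd (fwd_diff ^^ s) (\<lambda>y. (a + int p * int y) ^ q) 0"
proof -
  have "(a + int p * int y) ^ q =
      (\<Sum>j\<le>q. (of_nat (q choose j) * int p ^ j * a ^ (q - j)) * int y ^ j)" for y
    by (subst add.commute, subst binomial_ring) (simp add: power_mult_distrib algebra_simps)
  then have "(fwd_diff ^^ s) (\<lambda>y. (a + int p * int y) ^ q) 0 =
      (\<Sum>j\<le>q. (of_nat (q choose j) * int p ^ j * a ^ (q - j)) * (fact s * int (Stirling j s)))"
    by (simp only: funpow_fwd_diff_sum funpow_fwd_diff_power)
  moreover have "int p ^ s * fact s dvd
      (of_nat (q choose j) * int p ^ j * a ^ (q - j)) * (fact s * int (Stirling j s))" for j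
  proof (cases "s \<le> j")
    case True
    then have "int p ^ s dvd int p ^ j"
      by (rule le_imp_power_dvd)
    then have "int p ^ s * fact s dvd int p ^ j * fact s"
      by (rule mult_dvd_mono) simp
    then have "int p ^ s * fact s dvd
        (int p ^ j * fact s) * (of_nat (q choose j) * a ^ (q - j) * int (Stirling j s))"
      by (rule dvd_mult2)
    then show ?thesis by (simp add: ac_simps)
  next
    case False
    then show ?thesis by simp
  qed
  ultimately show ?thesis by (simp add: dvd_sum)
qed

section \<open>Binomial functions on residue classes\<close>

text \<open>On the class of i, \<open>x div p\<close> is (x - i) / p, so this is a Newton basis
  function of the class, extended by zero to the other classes.\<close>

definition class_binomial :: "nat \<Rightarrow> nat \<Rightarrow> nat \<Rightarrow> nat \<Rightarrow> int" where
  "class_binomial p i s x = (if x mod p = i then int ((x div p) choose s) else 0)"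

text \<open>Newton's formula in the variable \<open>x div p\<close> on the class of x. The range s
  \<le> k does not depend on x, so that differences can later be taken term by term.\<close>

lemma class_binomial_expansion:
  assumes "p > 0" "x \<le> k"
  shows "f x = (\<Sum>i<p. \<Sum>s\<le>k. (fwd_diff ^^ s) (\<lambda>y. f (i + p * y)) 0 * class_binomial p i s x)"
proof -
  let ?i = "x mod p" and ?y = "x div p"
  have "f x = f (?i + p * ?y)" by simp
  also have "\<dots> = (\<Sum>s\<le>?y. int (?y choose s) * (fwd_diff ^^ s) (\<lambda>y. f (?i + p * y)) 0)"
    using newton_forward[of "\<lambda>y. f (?i + p * y)" 0 ?y] by simp
  also have "\<dots> = (\<Sum>s\<le>k. int (?y choose s) * (fwd_diff ^^ s) (\<lambda>y. f (?i + p * y)) 0)"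
    by (rule sum.mono_neutral_left)
      (use assms div_le_dividend[of x p] in \<open>auto simp: binomial_eq_0 simp del: div_le_dividend\<close>)
  also have "\<dots> = (\<Sum>s\<le>k. (fwd_diff ^^ s) (\<lambda>y. f (?i + p * y)) 0 * class_binomial p ?i s x)"
    by (simp add: class_binomial_def mult.commute)
  also have "\<dots> = (\<Sum>i<p. if i = ?i then
      (\<Sum>s\<le>k. (fwd_diff ^^ s) (\<lambda>y. f (i + p * y)) 0 * class_binomial p i s x) else 0)"
    using assms by simp
  also have "\<dots> = (\<Sum>i<p. \<Sum>s\<le>k. (fwd_diff ^^ s) (\<lambda>y. f (i + p * y)) 0 * class_binomial p i s x)"
    by (rule sum.cong) (auto simp: class_binomial_def)
  finally show ?thesis .
qed

lemma class_binomial_shift: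
  assumes "p > 0"
  shows "class_binomial p i s (x + p) =
    class_binomial p i s x + (if s = 0 then 0 else class_binomial p i (s - 1) x)"
  using assms by (cases s) (auto simp: class_binomial_def)

text \<open>The first argument with a nonzero value is p s + i, which lies outside the window 0,
  ..., k.\<close>

lemma funpow_fwd_diff_class_binomial_eq_0:
  assumes "k < p * s + i" "i < p"
  shows "(fwd_diff ^^ k) (class_binomial p i s) 0 = 0"
proof -
  have "class_binomial p i s x = 0" if "x \<le> k" for x
  proof (cases "x mod p = i")
    case True
    have "x div p < s"
    proof (rule ccontr)
      assume "\<not> x div p < s"
      then have "p * s \<le> p * (x div p)" by simp
      then show False using True that assms(1) mult_div_mod_eq[of p x] by linarith
    qed
    then show ?thesis by (simp add: class_binomial_def binomial_eq_0)
  qed (simp add: class_binomial_def)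
  then have "(fwd_diff ^^ k) (class_binomial p i s) 0 = (fwd_diff ^^ k) (\<lambda>_. 0) 0"
    by (intro funpow_fwd_diff_cong) simp
  then show ?thesis by (simp add: funpow_fwd_diff_zero)
qed

text \<open>E^p = (1 + Delta)^p with the terms t = 0 and t = p isolated. So p orders of difference
  are traded either for a translation by p or for a coefficient divisible by p.\<close>

lemma funpow_fwd_diff_prime_step:
  assumes "prime p"
  shows "(fwd_diff ^^ (k + p)) f x =
    (fwd_diff ^^ k) (\<lambda>x. f (x + p) - f x) x - (\<Sum>t=1..<p. int (p choose t) * (fwd_diff ^^ (k + t)) f x)"
proof -
  have p: "p > 0" using assms by (simp add: prime_gt_0_nat)
  have "(fwd_diff ^^ k) f (x + p) = (\<Sum>t\<le>p. int (p choose t) * (fwd_diff ^^ (k + t)) f x)"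
    by (rule newton_forward_diff)
  also have "{..p} = insert 0 (insert p {1..<p})" using p by auto
  finally have "(fwd_diff ^^ k) f (x + p) = (fwd_diff ^^ k) f x + (fwd_diff ^^ (k + p)) f x +
      (\<Sum>t=1..<p. int (p choose t) * (fwd_diff ^^ (k + t)) f x)"
    using p by simp
  moreover have "(fwd_diff ^^ k) (\<lambda>x. f (x + p) - f x) x = (fwd_diff ^^ k) f (x + p) - (fwd_diff ^^ k) f x"
  proof -
    have "(fwd_diff ^^ k) (\<lambda>x. f (x + p) - f x + f x) x =
      (fwd_diff ^^ k) (\<lambda>x. f (x + p) - f x) x + (fwd_diff ^^ k) f x"
      by (rule funpow_fwd_diff_add)
    then show ?thesis by (simp add: funpow_fwd_diff_shift)
  qed
  ultimately show ?thesis by simp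
qed

lemma prime_dvd_choose_int:
  assumes "prime p" "t \<in> {1..<p}"
  shows "int p dvd int (p choose t)"
  using assms dvd_choose_prime[of t p] by (simp add: int_dvd_int_iff)

section \<open>Digit sums\<close>

lemma digit_sum_eq:
  assumes "m < p ^ N"
  shows "digit_sum p m = (\<Sum>i<N. digit p m i)"
  unfolding digit_sum_def
proof (rule sum.mono_neutral_left)
  show "{i. digit p m i \<noteq> 0} \<subseteq> {..<N}"
  proof
    fix i assume "i \<in> {i. digit p m i \<noteq> 0}"
    then have i: "digit p m i \<noteq> 0" by simp
    have "\<not> N \<le> i"
    proof
      assume "N \<le> i"
      \<comment> \<open>For p = 0 the bound on m leaves at most m = 0, all of whose digits are
        zero.\<close>
      have "p > 0" using assms i \<open>N \<le> i\<close> by (cases "p = 0"; cases i) (auto simp: digit_def power_0_left)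
      then have "m < p ^ i"
        using assms \<open>N \<le> i\<close> power_increasing[of N i p] by linarith
      then show False using i by (simp add: digit_def)
    qed
    then show "i \<in> {..<N}" by simp
  qed
qed auto

lemma digit_sum_0 [simp]: "digit_sum p 0 = 0"
  by (simp add: digit_sum_def digit_def)

lemma digit_sum_step:
  assumes "r < p" "p \<ge> 2"
  shows "digit_sum p (r + p * q) = r + digit_sum p q"
proof -
  \<comment> \<open>A crude count of digits is enough: q has at most q of them.\<close>
  have q: "q < p ^ q" using assms by (simp add: power_gt_expt)
  have "r + p * q < p * Suc q" using assms by simp
  also have "\<dots> \<le> p * p ^ q" using q by (intro mult_le_mono2) simp
  finally have "digit_sum p (r + p * q) = (\<Sum>i<Suc q. digit p (r + p * q) i)"
    by (intro digit_sum_eq) simp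
  also have "\<dots> = r + (\<Sum>i<q. digit p q i)"
    unfolding sum.lessThan_Suc_shift using assms by (simp add: digit_def div_mult2_eq)
  also have "(\<Sum>i<q. digit p q i) = digit_sum p q"
    using q by (simp add: digit_sum_eq)
  finally show ?thesis .
qed

lemma digit_sum_less:
  assumes "r < p" "p \<ge> 2"
  shows "digit_sum p r = r"
  using digit_sum_step[of r p 0] assms by simp

lemma digit_sum_split:
  assumes "a < p ^ j" "p \<ge> 2"
  shows "digit_sum p (a + p ^ j * b) = digit_sum p a + digit_sum p b"
  using assms(1)
proof (induction j arbitrary: a)
  case 0
  then show ?case by simp
next
  case (Suc j)
  let ?r = "a mod p" and ?q = "a div p"
  have r: "?r < p" using assms(2) by simp
  have "?q < p ^ j" using Suc.prems assms(2) by (simp add: less_mult_imp_div_less mult.commute)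
  then have IH: "digit_sum p (?q + p ^ j * b) = digit_sum p ?q + digit_sum p b"
    by (rule Suc.IH)
  have "p * (?q + p ^ j * b) = p * ?q + p ^ Suc j * b"
    by (simp add: algebra_simps)
  then have "a + p ^ Suc j * b = ?r + p * (?q + p ^ j * b)"
    using mod_mult_div_eq[of a p] by linarith
  then have "digit_sum p (a + p ^ Suc j * b) = ?r + digit_sum p (?q + p ^ j * b)"
    using digit_sum_step[OF r assms(2)] by simp
  moreover have "digit_sum p a = ?r + digit_sum p ?q"
    using digit_sum_step[OF r assms(2), of ?q] by simp
  ultimately show ?case using IH by simp
qed

text \<open>Casting out p - 1: p is congruent to 1.\<close>

lemma digit_sum_cong:
  assumes "p \<ge> 2"
  shows "[digit_sum p n = n] (mod (p - 1))"
proof (induction n rule: less_induct)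
  case (less n)
  show ?case
  proof (cases "n = 0")
    case False
    let ?r = "n mod p" and ?q = "n div p"
    have "[digit_sum p ?q = ?q] (mod (p - 1))"
      using False assms by (intro less.IH) simp
    moreover have "[?q = p * ?q] (mod (p - 1))"
    proof -
      have "p * ?q = ?q + (p - 1) * ?q"
        using assms by (cases p) auto
      then show ?thesis by (simp add: cong_def)
    qed
    ultimately have "[?r + digit_sum p ?q = ?r + p * ?q] (mod (p - 1))"
      by (intro cong_add cong_refl) (rule cong_trans)
    then show ?thesis
      using digit_sum_step[of ?r p ?q] assms by simp
  qed simp
qed

lemma digit_sum_pos:
  assumes "p \<ge> 2" "n > 0"
  shows "digit_sum p n > 0"
  using assms(2)
proof (induction n rule: less_induct)
  case (less n)
  have "digit_sum p n = n mod p + digit_sum p (n div p)"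
    using digit_sum_step[of "n mod p" p "n div p"] assms(1) by simp
  moreover have "n mod p > 0 \<or> digit_sum p (n div p) > 0"
  proof (cases "n mod p = 0")
    case True
    then have "n div p > 0" using less.prems mult_div_mod_eq[of p n] by (intro gr0I) auto
    then show ?thesis using less assms(1) by simp
  qed simp
  ultimately show ?case by linarith
qed

text \<open>Subtracting 1 turns each trailing zero of m into the digit p - 1 and lowers the last
  nonzero digit by 1.\<close>

lemma digit_sum_pred:
  assumes "prime p" "m > 0"
  shows "(p - 1) * multiplicity p m + digit_sum p m = digit_sum p (m - 1) + 1"
  using assms(2)
proof (induction m rule: less_induct)
  case (less m)
  have p: "p \<ge> 2" using assms(1) by (rule prime_ge_2_nat)
  define r q where "r = m mod p" and "q = m div p"
  have m: "m = r + p * q" and r: "r < p"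
    using p by (simp_all add: r_def q_def)
  show ?case
  proof (cases "r = 0")
    case False
    then have "\<not> p dvd m" using r_def by (simp add: dvd_eq_mod_eq_0)
    then have "multiplicity p m = 0" by (rule not_dvd_imp_multiplicity_0)
    moreover have "m - 1 = (r - 1) + p * q" using m False by simp
    then have "digit_sum p (m - 1) = r - 1 + digit_sum p q"
      using digit_sum_step[of "r - 1" p q] r p by simp
    moreover have "digit_sum p m = r + digit_sum p q"
      using digit_sum_step[OF r p, of q] m by simp
    ultimately show ?thesis using False by simp
  next
    case True
    then have mq: "m = p * q" and q: "q > 0" "q < m"
      using m less.prems p by auto
    have "m - 1 = (p - 1) + p * (q - 1)"
      using mq q p by (cases q) auto
    then have "digit_sum p (m - 1) = p - 1 + digit_sum p (q - 1)"
      using digit_sum_step[of "p - 1" p "q - 1"] p by simp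
    moreover have "digit_sum p m = digit_sum p q"
      using digit_sum_step[of 0 p q] mq p by simp
    moreover have "multiplicity p m = Suc (multiplicity p q)"
      unfolding mq using assms(1) q by (intro multiplicity_times_same) auto
    moreover have "(p - 1) * multiplicity p q + digit_sum p q = digit_sum p (q - 1) + 1"
      using less.IH[OF q(2,1)] .
    ultimately show ?thesis by simp
  qed
qed

text \<open>Legendre's formula, by telescoping \<open>digit_sum_pred\<close> over the factors of the
  factorial.\<close>

lemma legendre_digit_sum:
  assumes "prime p"
  shows "(p - 1) * multiplicity p (fact n) + digit_sum p n = n"
proof (induction n)
  case (Suc n)
  have "multiplicity p (fact (Suc n) :: nat) = multiplicity p (Suc n) + multiplicity p (fact n :: nat)"
    unfolding fact_Suc using assms by (subst prime_elem_multiplicity_mult_distrib) auto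
  then show ?case
    using Suc digit_sum_pred[OF assms, of "Suc n"] by (simp add: algebra_simps)
qed (use assms in simp)

text \<open>Kummer's theorem in digit sum form: Legendre's formula for n, k and n - k.\<close>

lemma multiplicity_binomial_digit_sum:
  assumes "prime p" "k \<le> n"
  shows "(p - 1) * multiplicity p (n choose k) + digit_sum p n = digit_sum p k + digit_sum p (n - k)"
proof -
  have "fact n = fact k * fact (n - k) * (n choose k)"
    using assms(2) binomial_fact_lemma[of k n] by simp
  then have "multiplicity p (fact n :: nat) =
      multiplicity p (fact k :: nat) + multiplicity p (fact (n - k) :: nat) + multiplicity p (n choose k)"
    using assms by (simp add: prime_elem_multiplicity_mult_distrib)
  then have "(p - 1) * multiplicity p (fact n :: nat) =
      (p - 1) * multiplicity p (fact k :: nat) + (p - 1) * multiplicity p (fact (n - k) :: nat) +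
      (p - 1) * multiplicity p (n choose k)"
    by (simp add: algebra_simps)
  then show ?thesis
    using legendre_digit_sum[OF assms(1), of n] legendre_digit_sum[OF assms(1), of k]
      legendre_digit_sum[OF assms(1), of "n - k"] assms(2)
    by linarith
qed

text \<open>There are u low digits of size at most p - 1, and above them a single digit smaller than
  K, since K \<le> p.\<close>

lemma digit_sum_bound:
  assumes "s < K * p ^ u" "K \<le> p" "p \<ge> 2"
  shows "digit_sum p s < (p - 1) * u + K"
  using assms(1)
proof (induction u arbitrary: s)
  case 0
  then show ?case using assms by (simp add: digit_sum_less)
next
  case (Suc u)
  have "s div p < K * p ^ u"
    using Suc.prems assms(3) by (simp add: less_mult_imp_div_less ac_simps)
  then have "digit_sum p (s div p) < (p - 1) * u + K" by (rule Suc.IH)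
  moreover have "digit_sum p s = s mod p + digit_sum p (s div p)"
    using digit_sum_step[of "s mod p" p "s div p"] assms(3) by simp
  moreover have "s mod p \<le> p - 1"
    using assms(3) by (simp add: less_Suc_eq_le[symmetric])
  ultimately show ?case by simp
qed

text \<open>Removing the v trailing zeros of s keeps its digit sum and replaces u by u - v, so each
  zero pays for its own p - 1.\<close>

lemma digit_sum_multiplicity_bound:
  assumes "prime p" "0 < s" "s < K * p ^ u" "K \<le> p"
  shows "digit_sum p s + (p - 1) * multiplicity p s < (p - 1) * u + K"
proof -
  have p: "p \<ge> 2" using assms(1) by (rule prime_ge_2_nat)
  define v where "v = multiplicity p s"
  obtain q where q: "s = p ^ v * q"
    using multiplicity_dvd[of p s] by (auto simp: v_def)
  have "v \<le> u"
  proof (rule ccontr)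
    assume "\<not> v \<le> u"
    then have "p ^ Suc u \<le> p ^ v" using p by (intro power_increasing) auto
    also have "\<dots> \<le> s" using q assms(2) by simp
    also have "\<dots> < K * p ^ u" by (rule assms(3))
    also have "\<dots> \<le> p ^ Suc u" using assms(4) by simp
    finally show False by simp
  qed
  then have "p ^ u = p ^ v * p ^ (u - v)" by (simp flip: power_add)
  then have "q < K * p ^ (u - v)"
    using assms(3) p unfolding q by (simp add: ac_simps)
  then have "digit_sum p q < (p - 1) * (u - v) + K"
    using digit_sum_bound assms(4) p by blast
  moreover have "digit_sum p s = digit_sum p q"
    using digit_sum_split[of 0 p v q] p q by simp
  moreover have "(p - 1) * u = (p - 1) * (u - v) + (p - 1) * v"
    using \<open>v \<le> u\<close> by (simp flip: distrib_left)
  ultimately show ?thesis unfolding v_def by linarith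
qed

section \<open>Divisibility of differences\<close>

text \<open>A factor p costs p - 1 orders of difference and a degree costs p. In the prime step the
  translation lowers s at the cost of p orders, and every other term supplies one factor p.\<close>

lemma prime_power_dvd_funpow_fwd_diff_class_binomial:
  assumes "prime p" "m * (p - 1) + p * s < k"
  shows "int p ^ m dvd (fwd_diff ^^ k) (class_binomial p i s) 0"
  using assms(2)
proof (induction k arbitrary: m s rule: less_induct)
  case (less k)
  have p: "p \<ge> 2" using assms(1) by (rule prime_ge_2_nat)
  show ?case
  proof (cases m)
    case (Suc m')
    define k0 where "k0 = k - p"
    have k: "k = k0 + p" using less.prems Suc p by (simp add: k0_def)
    \<comment> \<open>The middle terms have t \<ge> 1, hence order at least k0 + 1; this is why a
      factor p costs p - 1 orders and not p.\<close>
    have bound: "m' * (p - 1) + p * s < k0 + 1"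
    proof -
      have "(p - 1) + m' * (p - 1) + p * s < k0 + p"
        using less.prems unfolding Suc k by (simp only: mult_Suc)
      then show ?thesis using p by linarith
    qed
    have "int p ^ m dvd (fwd_diff ^^ k0) (\<lambda>x. class_binomial p i s (x + p) - class_binomial p i s x) 0"
    proof (cases s)
      case 0
      then show ?thesis using p by (simp add: class_binomial_shift funpow_fwd_diff_zero)
    next
      case (Suc s')
      have "int p ^ m dvd (fwd_diff ^^ k0) (class_binomial p i s') 0"
      proof (rule less.IH)
        have "m * (p - 1) + (p + p * s') < k0 + p"
          using less.prems unfolding Suc k by (simp only: mult_Suc_right)
        then show "m * (p - 1) + p * s' < k0" by linarith
        show "k0 < k" using k p by linarith
      qed
      then show ?thesis using Suc p by (simp add: class_binomial_shift)
    qed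
    moreover have "int p ^ m dvd
        int (p choose t) * (fwd_diff ^^ (k0 + t)) (class_binomial p i s) 0" if "t \<in> {1..<p}" for t
    proof -
      have "int p ^ m' dvd (fwd_diff ^^ (k0 + t)) (class_binomial p i s) 0"
      proof (rule less.IH)
        show "k0 + t < k" "m' * (p - 1) + p * s < k0 + t"
          using bound that k by simp_all
      qed
      with prime_dvd_choose_int[OF assms(1) that] show ?thesis
        unfolding Suc power_Suc by (rule mult_dvd_mono)
    qed
    ultimately show ?thesis
      unfolding k funpow_fwd_diff_prime_step[OF assms(1)] by (intro dvd_diff dvd_sum) auto
  qed simp
qed

text \<open>Let v be the valuation of m. From m C(n,m) = n C(n-1,m-1), p^h divides p^v C(n,m). As v
  < p^v \<le> m, p^(m-1) covers p^v and one factor p is left over.\<close>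

lemma prime_power_dvd_binomial_mult_power:
  assumes "prime p" "p ^ h dvd n" "m > 0"
  shows "p ^ Suc h dvd (n choose m) * p ^ m"
proof -
  define v where "v = multiplicity p m"
  obtain u where u: "m = p ^ v * u" "\<not> p dvd u"
    unfolding v_def
    by (rule multiplicity_decompose'[of m p]) (use assms not_prime_unit[of p] in auto)
  have "v < 2 ^ v" by (rule less_exp)
  also have "(2::nat) ^ v \<le> p ^ v" using assms(1) by (simp add: prime_ge_2_nat power_mono)
  also have "p ^ v \<le> m" using u assms(3) by (simp)
  finally have v: "v \<le> m - 1" by simp
  have "m * (n choose m) = n * (n - 1 choose (m - 1))"
    using assms(3) binomial_absorption[of "m - 1" n] by simp
  moreover have "m * (n choose m) = (p ^ v * u) * (n choose m)"
    using u(1) by simp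
  ultimately have "u * (p ^ v * (n choose m)) = n * (n - 1 choose (m - 1))"
    by (simp add: ac_simps)
  then have "p ^ h dvd u * (p ^ v * (n choose m))"
    using assms(2) by simp
  moreover have "coprime (p ^ h) u"
    using assms(1) u(2) by (simp add: prime_imp_coprime)
  ultimately have "p ^ h dvd p ^ v * (n choose m)"
    using coprime_dvd_mult_right_iff by blast
  also have "p ^ v * (n choose m) dvd p ^ (m - 1) * (n choose m)"
    using v by (intro mult_dvd_mono le_imp_power_dvd) auto
  finally have "p * p ^ h dvd p * (p ^ (m - 1) * (n choose m))"
    by (intro mult_dvd_mono) auto
  also have "p * (p ^ (m - 1) * (n choose m)) = (n choose m) * p ^ m"
    using assms(3) by (cases m) simp_all
  finally show ?thesis by simp
qed

text \<open>The first difference expands (a + p)^j - a^j into terms C(j,m) p^m with m \<ge> 1. Then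
  C(n,j) C(j,m) = C(n,m) C(n-m,j-m) brings in n and yields p^(h+1); the other s - 1 differences
  yield p^(s-1) (s-1)!.\<close>

lemma binomial_mult_funpow_fwd_diff_power_dvd:
  assumes "prime p" "p ^ h dvd n" "s > 0"
  shows "int p ^ (h + s) * fact (s - 1) dvd
    int (n choose j) * (fwd_diff ^^ s) (\<lambda>y. int (i + p * y) ^ j) 0"
proof (cases "j \<le> n")
  case True
  obtain s' where s: "s = Suc s'" using assms(3) by (cases s) auto
  let ?a = "\<lambda>y. int i + int p * int y"
  have fwd: "fwd_diff (\<lambda>y. int (i + p * y) ^ j) y =
      (\<Sum>m=1..j. (int (j choose m) * int p ^ m) * ?a y ^ (j - m))" for y
  proof -
    have "(int p + ?a y) ^ j = (\<Sum>m\<le>j. (int (j choose m) * int p ^ m) * ?a y ^ (j - m))"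
      by (simp add: binomial_ring)
    also have "{..j} = insert 0 {1..j}" by auto
    finally have "(int p + ?a y) ^ j - ?a y ^ j =
      (\<Sum>m=1..j. (int (j choose m) * int p ^ m) * ?a y ^ (j - m))" by simp
    moreover have "int (i + p * Suc y) = int p + ?a y" "int (i + p * y) = ?a y"
      by (simp_all add: algebra_simps)
    ultimately show ?thesis by (simp only: fwd_diff_def)
  qed
  have eq: "(fwd_diff ^^ s) (\<lambda>y. int (i + p * y) ^ j) 0 =
      (\<Sum>m=1..j. (int (j choose m) * int p ^ m) * (fwd_diff ^^ s') (\<lambda>y. ?a y ^ (j - m)) 0)"
    unfolding s funpow_fwd_diff_Suc' fwd[abs_def] by (rule funpow_fwd_diff_sum)
  have "int p ^ (h + s) * fact (s - 1) dvd
      int (n choose j) * ((int (j choose m) * int p ^ m) * (fwd_diff ^^ s') (\<lambda>y. ?a y ^ (j - m)) 0)"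
    if m: "m \<in> {1..j}" for m
  proof -
    have "(n choose j) * (j choose m) = (n choose m) * (n - m choose (j - m))"
      using m True by (intro choose_mult) auto
    then have AB: "int (n choose j) * int (j choose m) = int (n choose m) * int (n - m choose (j - m))"
      by (simp only: of_nat_mult[symmetric])
    define X where "X = (fwd_diff ^^ s') (\<lambda>y. ?a y ^ (j - m)) 0"
    have "int (n choose j) * ((int (j choose m) * int p ^ m) * X) =
        (int (n choose j) * int (j choose m)) * (int p ^ m * X)"
      by (simp only: ac_simps)
    also have "\<dots> = (int ((n choose m) * p ^ m) * X) * int (n - m choose (j - m))"
      unfolding AB by (simp add: ac_simps)
    finally have "int (n choose j) * ((int (j choose m) * int p ^ m) * X) =
        (int ((n choose m) * p ^ m) * X) * int (n - m choose (j - m))" .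
    moreover have "int (p ^ Suc h) dvd int ((n choose m) * p ^ m)"
      using prime_power_dvd_binomial_mult_power[OF assms(1,2)] m by (simp add: int_dvd_int_iff del: of_nat_mult of_nat_power)
    then have "int (p ^ Suc h) * (int p ^ s' * fact s') dvd int ((n choose m) * p ^ m) * X"
      unfolding X_def by (rule mult_dvd_mono[OF _ funpow_fwd_diff_arith_power_dvd])
    moreover have "int (p ^ Suc h) * (int p ^ s' * fact s') = int p ^ (h + s) * fact (s - 1)"
      by (simp add: s power_add)
    ultimately show ?thesis
      unfolding X_def[symmetric] by (simp only: dvd_mult2)
  qed
  then show ?thesis unfolding eq sum_distrib_left by (rule dvd_sum)
qed (simp add: binomial_eq_0)

text \<open>The coefficient supplies p^L, and the difference of the basis function has to supply
  only the missing p^(M-L).\<close>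

lemma class_term_dvd:
  assumes "prime p" "p ^ h dvd n" "s > 0"
    and bound: "M * (p - 1) + digit_sum p s + (p - 1) * multiplicity p s < k + (p - 1) * h"
  shows "int p ^ M dvd int (n choose j) * ((fwd_diff ^^ s) (\<lambda>y. int (i + p * y) ^ j) 0 *
    (fwd_diff ^^ k) (class_binomial p i s) 0)"
proof -
  have p: "p \<ge> 2" using assms(1) by (rule prime_ge_2_nat)
  define L where "L = h + s + multiplicity p (fact (s - 1) :: nat)"
  have "(p - 1) * multiplicity p (fact (s - 1) :: nat) + digit_sum p (s - 1) = s - 1"
    by (rule legendre_digit_sum[OF assms(1)])
  moreover have "(p - 1) * multiplicity p s + digit_sum p s = digit_sum p (s - 1) + 1"
    using digit_sum_pred[OF assms(1,3)] .
  moreover have "(p - 1) * L = (p - 1) * h + (p - 1) * s + (p - 1) * multiplicity p (fact (s - 1) :: nat)"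
    by (simp add: L_def algebra_simps)
  moreover have "(p - 1) * s + s = p * s" using p by (cases p) auto
  \<comment> \<open>Legendre's formula for s - 1, with the digit sum of s - 1 rewritten through s,
    makes the hypothesis \<open>bound\<close> exactly what p^(M-L) needs.\<close>
  ultimately have L: "(p - 1) * L + digit_sum p s + (p - 1) * multiplicity p s = (p - 1) * h + p * s"
    using assms(3) by linarith
  have "p ^ multiplicity p (fact (s - 1) :: nat) dvd fact (s - 1)"
    by (rule multiplicity_dvd)
  then have "int (p ^ multiplicity p (fact (s - 1) :: nat)) dvd int (fact (s - 1))"
    by (simp only: int_dvd_int_iff)
  then have "int p ^ multiplicity p (fact (s - 1) :: nat) dvd fact (s - 1)"
    by (simp add: of_nat_fact)
  then have "int p ^ L dvd int p ^ (h + s) * fact (s - 1)"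
    unfolding L_def power_add by (intro mult_dvd_mono) auto
  also have "\<dots> dvd int (n choose j) * (fwd_diff ^^ s) (\<lambda>y. int (i + p * y) ^ j) 0"
    by (rule binomial_mult_funpow_fwd_diff_power_dvd[OF assms(1-3)])
  finally have c: "int p ^ L dvd int (n choose j) * (fwd_diff ^^ s) (\<lambda>y. int (i + p * y) ^ j) 0" .
  have "int p ^ (M - L) dvd (fwd_diff ^^ k) (class_binomial p i s) 0"
  proof (cases "M \<le> L")
    case False
    then obtain d where "M = L + d"
      using nat_le_iff_add[of L M] by auto
    then have "M * (p - 1) = (M - L) * (p - 1) + (p - 1) * L"
      by (simp add: add_mult_distrib mult.commute)
    then show ?thesis
      using bound L
      by (intro prime_power_dvd_funpow_fwd_diff_class_binomial[OF assms(1)]) linarith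
  qed simp
  with c have "int p ^ (L + (M - L)) dvd (int (n choose j) * (fwd_diff ^^ s) (\<lambda>y. int (i + p * y) ^ j) 0) *
      (fwd_diff ^^ k) (class_binomial p i s) 0"
    unfolding power_add by (rule mult_dvd_mono)
  moreover have "int p ^ M dvd int p ^ (L + (M - L))"
    by (rule le_imp_power_dvd) simp
  ultimately show ?thesis unfolding mult.assoc by (rule dvd_trans[rotated])
qed

section \<open>Periodic powers\<close>

text \<open>Residues are taken in 1, ..., m, so r = m stands for the class of 0; n > 0 then forces r
  \<le> n.\<close>

lemma cong_residue_decomp:
  fixes n r m :: nat
  assumes "n > 0" "1 \<le> r" "r \<le> m" "[n = r] (mod m)"
  obtains q where "n = q * m + r"
proof -
  have "r \<le> n"
  proof (rule ccontr)
    assume "\<not> r \<le> n"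
    then have "n < m" "n < r" using assms(3) by auto
    then have "r mod m = n" using assms(4) by (simp add: cong_def)
    then show False using assms(1,3) \<open>n < r\<close> by (cases "r = m") auto
  qed
  then have "m dvd n - r" using assms(4) by (simp add: cong_altdef_nat)
  then obtain q where "n - r = m * q" ..
  then have "n = q * m + r" using \<open>r \<le> n\<close> by (simp add: mult.commute)
  then show ?thesis by (rule that)
qed

lemma fermat_cong:
  assumes "prime p"
  shows "[int y ^ p = int y] (mod int p)"
proof (induction y)
  case 0
  then show ?case using assms by (simp add: prime_gt_0_nat power_0_left)
next
  case (Suc y)
  have p: "p > 0" using assms by (simp add: prime_gt_0_nat)
  have "int (Suc y) ^ p = (\<Sum>t\<le>p. int (p choose t) * int y ^ t)"
    using binomial_ring[of "int y" 1 p] by (simp add: add.commute)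
  also have "{..p} = insert 0 (insert p {1..<p})" using p by auto
  finally have "int (Suc y) ^ p = (1 + int y ^ p) + (\<Sum>t=1..<p. int (p choose t) * int y ^ t)"
    using p by simp
  moreover have "int p dvd (\<Sum>t=1..<p. int (p choose t) * int y ^ t)"
    using prime_dvd_choose_int[OF assms] by (intro dvd_sum dvd_mult2) auto
  ultimately have "[int (Suc y) ^ p = 1 + int y ^ p] (mod int p)"
    by (simp add: cong_iff_dvd_diff)
  also have "[1 + int y ^ p = 1 + int y] (mod int p)"
    using Suc.IH by (intro cong_add cong_refl)
  finally show ?case by simp
qed

lemma prime_dvd_power_diff:
  assumes "prime p" "n > 0" "1 \<le> r" "r \<le> p - 1" "[n = r] (mod (p - 1))"
  shows "int p dvd int y ^ n - int y ^ r"
proof -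
  obtain q where q: "n = q * (p - 1) + r"
    using cong_residue_decomp[OF assms(2-5)] .
  have "[int y ^ (q * (p - 1) + r) = int y ^ r] (mod int p)"
  proof (induction q)
    case (Suc q)
    \<comment> \<open>One unit is borrowed from r \<ge> 1 to complete the exponent p that Fermat's
      theorem reduces; multiples of p are thus covered too.\<close>
    have "Suc q * (p - 1) + r = p + (q * (p - 1) + (r - 1))"
      using assms(3) prime_gt_0_nat[OF assms(1)] by simp
    then have "int y ^ (Suc q * (p - 1) + r) = int y ^ p * int y ^ (q * (p - 1) + (r - 1))"
      by (simp only: power_add)
    also have "[\<dots> = int y * int y ^ (q * (p - 1) + (r - 1))] (mod int p)"
      using fermat_cong[OF assms(1)] by (intro cong_mult cong_refl)
    also have "int y * int y ^ (q * (p - 1) + (r - 1)) = int y ^ (q * (p - 1) + r)"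
      using assms(3) by (simp flip: power_Suc)
    finally show ?case using Suc.IH by (rule cong_trans)
  qed simp
  then show ?thesis by (simp add: q cong_iff_dvd_diff)
qed

text \<open>For k < p the window stays below p, where reduction modulo p is the identity and Fermat
  replaces the exponent n by r.\<close>

lemma residue_power_base:
  assumes "prime p" "n > 0" "1 \<le> r" "r \<le> p - 1" "[n = r] (mod (p - 1))" "k < p"
  shows "int p dvd (fwd_diff ^^ k) (\<lambda>x. int (x mod p) ^ n) 0 - fact k * int (Stirling r k)"
proof -
  let ?g = "\<lambda>x. int x ^ n - int x ^ r"
  have "(fwd_diff ^^ k) (\<lambda>x. int (x mod p) ^ n) 0 = (fwd_diff ^^ k) (\<lambda>x. ?g x + int x ^ r) 0"
    using assms(6) by (intro funpow_fwd_diff_cong) simp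
  also have "\<dots> = (fwd_diff ^^ k) ?g 0 + fact k * int (Stirling r k)"
    by (simp only: funpow_fwd_diff_add funpow_fwd_diff_power)
  finally show ?thesis
    using funpow_fwd_diff_dvd[of "int p" ?g k 0] prime_dvd_power_diff[OF assms(1-5)] by simp
qed

lemma residue_power_step:
  assumes "prime p"
  shows "(fwd_diff ^^ (k + p)) (\<lambda>x. int (x mod p) ^ n) 0 =
    - (\<Sum>t=1..<p. int (p choose t) * (fwd_diff ^^ (k + t)) (\<lambda>x. int (x mod p) ^ n) 0)"
  by (simp add: funpow_fwd_diff_prime_step[OF assms] funpow_fwd_diff_zero)

text \<open>Periodicity kills the translation term of the prime step, so every remaining term gains
  a factor p.\<close>

lemma residue_power_dvd:
  assumes "prime p" "n > 0" "1 \<le> r" "r \<le> p - 1" "[n = r] (mod (p - 1))"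
    and "m * (p - 1) + r < k + (p - 1)"
  shows "int p ^ m dvd (fwd_diff ^^ k) (\<lambda>x. int (x mod p) ^ n) 0"
  using assms(6)
proof (induction k arbitrary: m rule: less_induct)
  case (less k)
  show ?case
  proof (cases m)
    case (Suc m')
    then have bound: "m' * (p - 1) + r < k" using less.prems by simp
    show ?thesis
    proof (cases "k < p")
      case True
      \<comment> \<open>Only one factor p is then claimed, and it comes from S(r,k) = 0, as r <
        k.\<close>
      have "m' = 0"
      proof (rule ccontr)
        assume "m' \<noteq> 0"
        then have "1 * (p - 1) \<le> m' * (p - 1)" by (intro mult_le_mono1) simp
        then show False using bound True assms(3) by linarith
      qed
      then show ?thesis
        using residue_power_base[OF assms(1-5) True] bound Suc by simp
    next
      case False
      define k0 where "k0 = k - p"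
      have k: "k = k0 + p" using False by (simp add: k0_def)
      have "int p ^ m dvd int (p choose t) * (fwd_diff ^^ (k0 + t)) (\<lambda>x. int (x mod p) ^ n) 0"
        if t: "t \<in> {1..<p}" for t
      proof -
        have "int p ^ m' dvd (fwd_diff ^^ (k0 + t)) (\<lambda>x. int (x mod p) ^ n) 0"
        proof (rule less.IH)
          show "k0 + t < k" using t k by simp
          have "1 \<le> t" using t by simp
          then show "m' * (p - 1) + r < k0 + t + (p - 1)" using bound k by linarith
        qed
        with prime_dvd_choose_int[OF assms(1) t] show ?thesis
          unfolding Suc power_Suc by (rule mult_dvd_mono)
      qed
      then show ?thesis
        unfolding k residue_power_step[OF assms(1)] dvd_minus_iff by (rule dvd_sum)
    qed
  qed simp
qed

text \<open>The start r! is prime to p. In the recursion only t = 1 decides: its coefficient is p,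
  and the terms with t \<ge> 2 contain one more factor p.\<close>

lemma residue_power_not_dvd:
  assumes "prime p" "n > 0" "1 \<le> r" "r \<le> p - 1" "[n = r] (mod (p - 1))"
  shows "\<not> int p ^ Suc N dvd (fwd_diff ^^ (N * (p - 1) + r)) (\<lambda>x. int (x mod p) ^ n) 0"
proof (induction N)
  case 0
  have p: "p \<ge> 2" using assms(1) by (rule prime_ge_2_nat)
  have "\<not> p dvd fact r"
    using assms p by (simp add: prime_dvd_fact_iff)
  then have "\<not> int p dvd fact r"
    by (metis int_dvd_int_iff of_nat_fact)
  moreover have "int p dvd (fwd_diff ^^ r) (\<lambda>x. int (x mod p) ^ n) 0 - fact r"
    using residue_power_base[OF assms, of r] assms(4) p by simp
  ultimately show ?case
    using dvd_diff[of "int p" "(fwd_diff ^^ r) (\<lambda>x. int (x mod p) ^ n) 0"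
      "(fwd_diff ^^ r) (\<lambda>x. int (x mod p) ^ n) 0 - fact r"] by auto
next
  case (Suc N)
  let ?b = "\<lambda>k. (fwd_diff ^^ k) (\<lambda>x. int (x mod p) ^ n) 0"
  have p: "p \<ge> 2" using assms(1) by (rule prime_ge_2_nat)
  \<comment> \<open>Chosen so that k0 + 1 is the order of the previous stage and k0 + p that of the
    current one.\<close>
  define k0 where "k0 = N * (p - 1) + r - 1"
  have k0: "k0 + 1 = N * (p - 1) + r" and k: "Suc N * (p - 1) + r = k0 + p"
    using assms(3) p by (simp_all add: k0_def)
  have "{1..<p} = insert 1 {2..<p}" using p by auto
  then have eq: "?b (k0 + p) = - (int p * ?b (k0 + 1)) - (\<Sum>t=2..<p. int (p choose t) * ?b (k0 + t))"
    unfolding residue_power_step[OF assms(1)] by simp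
  have "int p ^ Suc (Suc N) dvd int (p choose t) * ?b (k0 + t)" if t: "t \<in> {2..<p}" for t
  proof -
    have "int p ^ Suc N dvd ?b (k0 + t)"
    proof (rule residue_power_dvd[OF assms])
      have "2 \<le> t" using t by simp
      then show "Suc N * (p - 1) + r < k0 + t + (p - 1)" using k p by linarith
    qed
    moreover have "int p dvd int (p choose t)"
      using prime_dvd_choose_int[OF assms(1)] t by simp
    ultimately show ?thesis unfolding power_Suc[of _ "Suc N"] by (intro mult_dvd_mono)
  qed
  then have rest: "int p ^ Suc (Suc N) dvd (\<Sum>t=2..<p. int (p choose t) * ?b (k0 + t))"
    by (rule dvd_sum)
  show ?case
  proof
    assume "int p ^ Suc (Suc N) dvd ?b (Suc N * (p - 1) + r)"
    then have "int p ^ Suc (Suc N) dvd - (int p * ?b (k0 + 1))"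
      using dvd_add[OF _ rest] unfolding k eq by force
    then have "int p * int p ^ Suc N dvd int p * ?b (k0 + 1)" by simp
    then have "int p ^ Suc N dvd ?b (k0 + 1)"
      using p by (simp only: dvd_mult_cancel_left) simp
    then show False using Suc.IH unfolding k0 by simp
  qed
qed

section \<open>Valuations of Stirling numbers\<close>

lemma funpow_fwd_diff_class_expansion:
  assumes "p > 0"
  shows "(fwd_diff ^^ k) f 0 = (\<Sum>i<p. \<Sum>s\<le>k.
    (fwd_diff ^^ s) (\<lambda>y. f (i + p * y)) 0 * (fwd_diff ^^ k) (class_binomial p i s) 0)"
proof -
  \<comment> \<open>The double sum is flattened to pairs z = (i, s) so that linearity over a single
    index set applies.\<close>
  let ?c = "\<lambda>z. (fwd_diff ^^ snd z) (\<lambda>y. f (fst z + p * y)) 0"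
  let ?F = "\<lambda>z. class_binomial p (fst z) (snd z)"
  have "(fwd_diff ^^ k) f 0 = (fwd_diff ^^ k) (\<lambda>x. \<Sum>z\<in>{..<p} \<times> {..k}. ?c z * ?F z x) 0"
  proof (rule funpow_fwd_diff_cong)
    fix y assume "y \<le> k"
    then show "f (0 + y) = (\<Sum>z\<in>{..<p} \<times> {..k}. ?c z * ?F z (0 + y))"
      using class_binomial_expansion[OF assms, of y k f]
      by (simp add: sum.cartesian_product case_prod_beta)
  qed
  also have "\<dots> = (\<Sum>z\<in>{..<p} \<times> {..k}. ?c z * (fwd_diff ^^ k) (?F z) 0)"
    by (rule funpow_fwd_diff_sum)
  finally show ?thesis by (simp add: sum.cartesian_product case_prod_beta)
qed

text \<open>Each term of the class expansion is divisible by itself: degree 0 by the order of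
  difference alone, degrees with p s + i > k because they vanish, all others by the digit sum
  bound.\<close>

lemma binomial_Stirling_dvd:
  assumes "prime p" "p ^ h dvd n" "1 \<le> r" "r \<le> p - 1"
    and k: "k = N * (p - 1) + r" "k \<le> r * p ^ h"
  shows "p ^ N dvd (n choose j) * (fact k * Stirling j k)"
proof -
  have p: "p \<ge> 2" using assms(1) by (rule prime_ge_2_nat)
  have "int p ^ N dvd int (n choose j) * ((fwd_diff ^^ s) (\<lambda>y. int (i + p * y) ^ j) 0 *
      (fwd_diff ^^ k) (class_binomial p i s) 0)" if i: "i < p" for i s
  proof (cases "s = 0 \<or> k < p * s + i")
    case True
    then have "int p ^ N dvd (fwd_diff ^^ k) (class_binomial p i s) 0"
    proof
      assume "s = 0"
      then show ?thesis
        using k(1) assms(3) by (intro prime_power_dvd_funpow_fwd_diff_class_binomial[OF assms(1)]) simp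
    qed (simp add: funpow_fwd_diff_class_binomial_eq_0 i)
    then show ?thesis by simp
  next
    case False
    then have s: "s > 0" "p * s \<le> k" by auto
    \<comment> \<open>The factor 1 is the \<open>K\<close> of
      \<open>digit_sum_multiplicity_bound\<close>; the resulting bound suffices because k exceeds N
      (p - 1) by r \<ge> 1.\<close>
    have "p * s < p * (1 * p ^ h)"
    proof -
      have "p * s \<le> r * p ^ h" using s(2) k(2) by linarith
      also have "\<dots> < p * p ^ h" using assms(4) p by simp
      finally show ?thesis by simp
    qed
    then have "s < 1 * p ^ h" using p by (simp only: mult_less_cancel1)
    then have "digit_sum p s + (p - 1) * multiplicity p s < (p - 1) * h + 1"
      using s(1) p by (intro digit_sum_multiplicity_bound[OF assms(1)]) auto
    then show ?thesis
      using k(1) assms(3) by (intro class_term_dvd[OF assms(1,2) s(1)]) linarith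
  qed
  then have "int p ^ N dvd int (n choose j) * (fwd_diff ^^ k) (\<lambda>x. int x ^ j) 0"
    unfolding funpow_fwd_diff_class_expansion[of p k "\<lambda>x. int x ^ j", OF prime_gt_0_nat[OF assms(1)]]
      sum_distrib_left
    by (intro dvd_sum) auto
  then have "int (p ^ N) dvd int ((n choose j) * (fact k * Stirling j k))"
    by (simp add: funpow_fwd_diff_power)
  then show ?thesis by (simp only: int_dvd_int_iff)
qed

(* x^n is split into its part on multiples of p, divisible by p^n, the periodic function
   (x mod p)^n, whose differences are known exactly, and a remainder of higher valuation. *)
lemma multiplicity_fact_Stirling:
  assumes "prime p" "p ^ h dvd n" "n > 0" "1 \<le> r" "r \<le> p - 1" "[n = r] (mod (p - 1))"
    and k: "k = N * (p - 1) + r" "k \<le> r * p ^ h"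
  shows "multiplicity p (fact k * Stirling n k) = N"
proof -
  have p: "p \<ge> 2" using assms(1) by (rule prime_ge_2_nat)
  define f1 where "f1 x = (if p dvd x then int x ^ n else 0)" for x
  define g where "g x = (if p dvd x then 0 else int x ^ n - int (x mod p) ^ n)" for x
  have "(fwd_diff ^^ k) (\<lambda>x. int x ^ n) 0 = (fwd_diff ^^ k) (\<lambda>x. (f1 x + g x) + int (x mod p) ^ n) 0"
    using assms(3) by (intro funpow_fwd_diff_cong) (auto simp: f1_def g_def)
  then have split: "fact k * int (Stirling n k) =
      ((fwd_diff ^^ k) f1 0 + (fwd_diff ^^ k) g 0) + (fwd_diff ^^ k) (\<lambda>x. int (x mod p) ^ n) 0"
    by (simp only: funpow_fwd_diff_add funpow_fwd_diff_power)

  \<comment> \<open>This lets p^n absorb p^(N+1) on multiples of p: k \<le> r p^h and r \<le> p - 1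
    give N \<le> p^h - 1 < n.\<close>
  have "Suc N \<le> n"
  proof -
    have "N * (p - 1) + r \<le> r * p ^ h" using k by simp
    also have "\<dots> = r * (p ^ h - 1) + r" using p by (simp add: right_diff_distrib')
    also have "r * (p ^ h - 1) \<le> (p - 1) * (p ^ h - 1)" using assms(5) by (intro mult_le_mono1)
    finally have "N * (p - 1) \<le> (p ^ h - 1) * (p - 1)" by (simp add: mult.commute)
    then have "N \<le> p ^ h - 1" using p by (simp only: mult_le_cancel2)
    moreover have "p ^ h \<le> n" using assms(2,3) by (intro dvd_imp_le)
    moreover have "p ^ h > 0" using p by simp
    ultimately show ?thesis by linarith
  qed
  then have "int p ^ Suc N dvd int p ^ n" by (rule le_imp_power_dvd)
  then have "int p ^ Suc N dvd int y ^ n" if "p dvd y" for y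
    using that by (meson dvd_power_same dvd_trans int_dvd_int_iff)
  then have "int p ^ Suc N dvd f1 y" for y
    by (simp add: f1_def del: power_Suc)
  then have f1: "int p ^ Suc N dvd (fwd_diff ^^ k) f1 0"
    by (rule funpow_fwd_diff_dvd)

  have "int p ^ Suc N dvd (fwd_diff ^^ s) (\<lambda>y. g (i + p * y)) 0 * (fwd_diff ^^ k) (class_binomial p i s) 0"
    if i: "i < p" for i s
  proof (cases "i = 0 \<or> s = 0 \<or> k < p * s + i")
    case True
    consider "i = 0" | "i > 0" "s = 0" | "k < p * s + i" using True by auto
    then show ?thesis
    proof cases
      case 1
      then show ?thesis by (simp add: g_def funpow_fwd_diff_zero)
    next
      case 2
      \<comment> \<open>The degree 0 coefficient is g(i) = i^n - i^n; removing it is the purpose of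
        subtracting the periodic part.\<close>
      then show ?thesis using i by (simp add: g_def)
    next
      case 3
      then show ?thesis by (simp add: funpow_fwd_diff_class_binomial_eq_0 i)
    qed
  next
    case False
    then have s: "s > 0" "p * s < k" and "i > 0" by auto
    obtain s' where s': "s = Suc s'" using s(1) by (cases s) auto
    have "\<not> p dvd i + p * y" for y
      using i \<open>i > 0\<close> by (auto simp: dvd_add_left_iff dest: dvd_imp_le)
    \<comment> \<open>On the class of i > 0, g differs from the n-th power by the constant i^n,
      which one difference kills.\<close>
    then have "fwd_diff (\<lambda>y. g (i + p * y)) = fwd_diff (\<lambda>y. int (i + p * y) ^ n)"
      using i by (simp add: fwd_diff_def g_def fun_eq_iff del: of_nat_add of_nat_mult mult_Suc_right)
    then have c: "(fwd_diff ^^ s) (\<lambda>y. g (i + p * y)) 0 = (fwd_diff ^^ s) (\<lambda>y. int (i + p * y) ^ n) 0"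
      by (simp only: s' funpow_fwd_diff_Suc')
    have "h > 0"
    proof (rule ccontr)
      assume "\<not> h > 0"
      then have "p * s < r" using s(2) k(2) by simp
      moreover have "p * 1 \<le> p * s" using s(1) by (intro mult_le_mono2) simp
      ultimately show False using assms(5) p by linarith
    qed
    then obtain h' where h': "h = Suc h'" by (cases h) auto
    have "r * p ^ h = p * (r * p ^ h')" by (simp add: h')
    \<comment> \<open>Here K = r and u = h - 1, sharper than s < p^h: this gains the extra factor
      p.\<close>
    then have "p * s < p * (r * p ^ h')" using s(2) k(2) by linarith
    then have "s < r * p ^ h'" by simp
    then have "digit_sum p s + (p - 1) * multiplicity p s < (p - 1) * h' + r"
      using s(1) assms(5) by (intro digit_sum_multiplicity_bound[OF assms(1)]) auto
    then have "Suc N * (p - 1) + digit_sum p s + (p - 1) * multiplicity p s < k + (p - 1) * h"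
      using k(1) by (simp add: h')
    from class_term_dvd[OF assms(1,2) s(1) this, of n i] show ?thesis
      by (simp add: c)
  qed
  then have g: "int p ^ Suc N dvd (fwd_diff ^^ k) g 0"
    unfolding funpow_fwd_diff_class_expansion[of p k g, OF prime_gt_0_nat[OF assms(1)]]
    by (intro dvd_sum) auto

  have "int p ^ Suc N dvd (fwd_diff ^^ k) f1 0 + (fwd_diff ^^ k) g 0"
    using f1 g by (rule dvd_add)
  then have "\<not> int p ^ Suc N dvd fact k * int (Stirling n k)"
    using residue_power_not_dvd[OF assms(1,3-6), of N] k(1)
    unfolding split by (simp only: dvd_add_right_iff) simp
  then have "\<not> int (p ^ Suc N) dvd int (fact k * Stirling n k)" by simp
  then have "\<not> p ^ Suc N dvd fact k * Stirling n k"
    unfolding int_dvd_int_iff .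
  moreover have "p ^ N dvd fact k * Stirling n k"
    using binomial_Stirling_dvd[OF assms(1,2,4,5) k, of n] by simp
  ultimately show ?thesis by (intro multiplicity_eqI)
qed

section \<open>Coefficients of higher order Bernoulli polynomials\<close>

text \<open>The exponential generating function of k! S(n,k). Writing e^t = (e^t - 1) + 1 in the
  derivative yields the Stirling recurrence.\<close>

lemma fps_exp_minus_1_power_nth:
  "(fps_exp (1 :: rat) - 1) ^ k $ n = of_nat (fact k * Stirling n k) / fact n"
proof (induction n arbitrary: k)
  case 0
  show ?case by (cases k) simp_all
next
  case (Suc n)
  let ?E = "fps_exp (1 :: rat) - 1"
  show ?case
  proof (cases k)
    case 0
    then show ?thesis by simp
  next
    case (Suc j)
    have "fps_deriv (?E ^ Suc j) = fps_const (of_nat (Suc j)) * (fps_exp 1 * ?E ^ j)"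
      by (simp add: fps_deriv_power mult.assoc del: of_nat_Suc power_Suc)
    also have "fps_exp 1 * ?E ^ j = ?E ^ Suc j + ?E ^ j"
      by (simp add: algebra_simps)
    finally have "of_nat (Suc n) * ?E ^ Suc j $ Suc n = of_nat (Suc j) * (?E ^ Suc j $ n + ?E ^ j $ n)"
      by (metis Suc_eq_plus1 fps_add_nth fps_deriv_nth fps_mult_left_const_nth)
    also have "\<dots> = of_nat (fact k * Stirling (Suc n) k) / fact n"
      unfolding Suc.IH Suc by (simp add: field_simps)
    finally show ?thesis
      unfolding Suc by (simp add: field_simps del: power_Suc of_nat_Suc)
  qed
qed

lemma fps_X_div_exp_powi_nth:
  "(fps_X / (fps_exp (1 :: rat) - 1)) powi (- int k) $ q =
    of_nat (fact k * Stirling (q + k) k) / fact (q + k)"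
proof -
  \<comment> \<open>G is the unit (e^t - 1) / t, so the power in question is G^k, that is, (e^t -
    1)^k shifted by k places.\<close>
  define G :: "rat fps" where "G = Abs_fps (\<lambda>i. 1 / fact (Suc i))"
  let ?E = "fps_exp (1 :: rat) - 1"
  have G0: "G $ 0 \<noteq> 0" by (simp add: G_def)
  have E: "?E = fps_X * G"
  proof (rule fps_ext)
    fix i show "?E $ i = (fps_X * G) $ i"
      by (cases i) (simp_all add: G_def algebra_simps)
  qed
  have "fps_X = ?E * inverse G"
    using G0 by (simp add: E mult.assoc inverse_mult_eq_1')
  moreover have "?E \<noteq> 0" using G0 by (auto simp: E)
  ultimately have "fps_X / ?E = inverse G"
    by (metis nonzero_mult_div_cancel_left)
  then have powi: "(fps_X / ?E) powi (- int k) = G ^ k"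
    using G0 by (simp add: power_int_def fps_inverse_idempotent)
  have "G ^ k $ q = (fps_X ^ k * G ^ k) $ (q + k)"
    by (simp add: fps_X_power_mult_nth)
  also have "fps_X ^ k * G ^ k = ?E ^ k" by (simp only: E power_mult_distrib)
  finally show ?thesis by (simp only: powi fps_exp_minus_1_power_nth)
qed

lemma coeff_bernoulli_poly_ho:
  "coeff (bernoulli_poly_ho l m) r =
    (if r \<le> m then fact m * (fps_X / (fps_exp 1 - 1)) powi l $ (m - r) / fact r else 0)"
proof -
  let ?c = "\<lambda>i. (fps_X / (fps_exp (1 :: rat) - 1)) powi l $ i"
  have "coeff (bernoulli_poly_ho l m) r =
      fact m * (\<Sum>i=0..m. ?c i * coeff (monom (1 / fact (m - i)) (m - i)) r)"
    by (simp add: bernoulli_poly_ho_def fps_mult_nth coeff_sum)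
  also have "(\<Sum>i=0..m. ?c i * coeff (monom (1 / fact (m - i)) (m - i)) r) =
      (\<Sum>i=0..m. if i = m - r \<and> r \<le> m then ?c i / fact r else 0)"
    by (rule sum.cong) auto
  also have "\<dots> = (if r \<le> m then ?c (m - r) / fact r else 0)"
    by simp
  finally show ?thesis by simp
qed

lemma coeff_bernoulli_poly_ho_neg:
  assumes "k \<le> n" "r \<le> n - k"
  shows "coeff (bernoulli_poly_ho (- int k) (n - k)) r =
    of_nat ((n choose (n - r)) * Stirling (n - r) k) / of_nat (n choose k)"
proof -
  have 1: "n - k - r + k = n - r" using assms by simp
  have 2: "(of_nat (n choose (n - r)) :: rat) = fact n / (fact (n - r) * fact r)"
    using binomial_fact[of "n - r" n, where ?'a = rat] assms by simp
  have 3: "(of_nat (n choose k) :: rat) = fact n / (fact k * fact (n - k))"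
    using binomial_fact[OF assms(1), where ?'a = rat] .
  show ?thesis
    unfolding coeff_bernoulli_poly_ho fps_X_div_exp_powi_nth of_nat_mult 1 2 3
    using assms(2) by (simp add: field_simps)
qed

lemma Stirling_pos:
  assumes "0 < k" "k \<le> n"
  shows "Stirling n k > 0"
  using assms
proof (induction n arbitrary: k)
  case (Suc n)
  show ?case
  proof (cases "k = Suc n")
    case False
    then have "Stirling n k > 0" using Suc by simp
    then show ?thesis using Suc.prems by (cases k) simp_all
  qed (simp del: Stirling.simps)
qed simp

lemma multiplicity_int_int: "multiplicity (int p) (int a) = multiplicity p a"
proof -
  have "int p ^ i dvd int a \<longleftrightarrow> p ^ i dvd a" for i
    by (simp only: int_dvd_int_iff of_nat_power[symmetric])
  then show ?thesis by (simp add: multiplicity_def)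
qed

text \<open>Cross-multiplication with the reduced fraction of \<open>quotient_of\<close> shows that
  any representation gives the same difference of valuations.\<close>

lemma rat_valuation_quotient:
  assumes "prime p" "a > 0" "b > 0"
  shows "rat_valuation p (of_nat a / of_nat b) = int (multiplicity p a) - int (multiplicity p b)"
proof -
  obtain x y where q: "quotient_of (of_nat a / of_nat b) = (x, y)"
    by (cases "quotient_of (of_nat a / of_nat b :: rat)")
  have y: "y > 0" using quotient_of_denom_pos[OF q] .
  have "(of_nat a / of_nat b :: rat) = of_int x / of_int y" using quotient_of_div[OF q] .
  then have "(of_int (int a * y) :: rat) = of_int (x * int b)"
    using assms y by (simp add: field_simps)
  then have eq: "int a * y = x * int b" by (simp only: of_int_eq_iff)
  then have x: "x \<noteq> 0" using assms y by auto
  have p: "prime (int p)" using assms(1) by simp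
  have "multiplicity (int p) (int a) + multiplicity (int p) y =
      multiplicity (int p) x + multiplicity (int p) (int b)"
    using arg_cong[OF eq, of "multiplicity (int p)"] p assms x y
    by (simp add: prime_elem_multiplicity_mult_distrib)
  then have "multiplicity p a + multiplicity (int p) y = multiplicity (int p) x + multiplicity p b"
    by (simp only: multiplicity_int_int)
  then show ?thesis by (simp add: rat_valuation_def q)
qed

text \<open>All coefficients up to degree n - k are nonzero, so the minimum runs over all j = n - r
  between k and n; \<open>j0\<close> attains it.\<close>

lemma maximum_pole_bernoulli_poly_ho:
  assumes "prime p" "0 < k" "k \<le> n"
    and least: "\<And>j. k \<le> j \<Longrightarrow> j \<le> n \<Longrightarrow> e \<le> multiplicity p ((n choose j) * Stirling j k)"
    and attained: "k \<le> j0" "j0 \<le> n" "multiplicity p ((n choose j0) * Stirling j0 k) = e"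
  shows "maximum_pole p (bernoulli_poly_ho (- int k) (n - k)) = int (multiplicity p (n choose k)) - int e"
proof -
  let ?f = "bernoulli_poly_ho (- int k) (n - k)"
  have coeff: "coeff ?f r \<noteq> 0 \<and> rat_valuation p (coeff ?f r) =
      int (multiplicity p ((n choose (n - r)) * Stirling (n - r) k)) - int (multiplicity p (n choose k))"
    if "r \<le> n - k" for r
  proof -
    have "(n choose (n - r)) * Stirling (n - r) k > 0" "n choose k > 0"
      using assms(2,3) that Stirling_pos[of k "n - r"] by (auto simp: zero_less_binomial)
    then show ?thesis
      unfolding coeff_bernoulli_poly_ho_neg[OF assms(3) that]
      using rat_valuation_quotient[OF assms(1)] by (auto simp del: of_nat_mult)
  qed
  have "coeff ?f r = 0" if "\<not> r \<le> n - k" for r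
    using that by (simp add: coeff_bernoulli_poly_ho)
  then have S: "{i. coeff ?f i \<noteq> 0} = {..n - k}"
    using coeff by auto
  have "Min ((\<lambda>i. rat_valuation p (coeff ?f i)) ` {i. coeff ?f i \<noteq> 0}) =
      int e - int (multiplicity p (n choose k))"
    unfolding S
  proof (rule Min_eqI)
    fix v assume "v \<in> (\<lambda>i. rat_valuation p (coeff ?f i)) ` {..n - k}"
    then obtain r where r: "r \<le> n - k" "v = rat_valuation p (coeff ?f r)" by auto
    then have "e \<le> multiplicity p ((n choose (n - r)) * Stirling (n - r) k)"
      using assms(3) by (intro least) auto
    then show "int e - int (multiplicity p (n choose k)) \<le> v"
      using coeff[OF r(1)] r(2) by simp
  next
    have "n - j0 \<le> n - k" "n - (n - j0) = j0" using attained by auto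
    then show "int e - int (multiplicity p (n choose k)) \<in> (\<lambda>i. rat_valuation p (coeff ?f i)) ` {..n - k}"
      using coeff[of "n - j0"] attained(3) by (intro image_eqI[of _ _ "n - j0"]) auto
  qed simp
  then show ?thesis by (simp add: maximum_pole_def)
qed

section \<open>Bottom segments\<close>

lemma sum_digits_eq_mod: "(\<Sum>i<j. digit p n i * p ^ i) = n mod p ^ j"
  by (induction j) (simp_all add: digit_def mod_mult2_eq mult.commute[of p])

lemma bottom_segment_iff:
  "bottom_segment p n s \<longleftrightarrow> (\<exists>j m. m \<le> digit p n j \<and> s = n mod p ^ j + m * p ^ j)"
  by (simp add: bottom_segment_def sum_digits_eq_mod)

lemma digit_less: "p > 0 \<Longrightarrow> digit p n j < p"
  by (simp add: digit_def)

lemma digit_sum_bottom_segment: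
  assumes "p \<ge> 2" "m \<le> digit p n j"
  shows "digit_sum p (n mod p ^ j + m * p ^ j) = digit_sum p (n mod p ^ j) + m"
proof -
  have "m < p" using assms digit_less[of p n j] by simp
  then show ?thesis
    using digit_sum_split[of "n mod p ^ j" p j m] assms(1) by (simp add: digit_sum_less mult.commute)
qed

text \<open>A discrete intermediate value argument: each new digit raises the digit sum of the
  segment, and the partial digit m takes every value in between.\<close>

lemma ex_bottom_segment_digit_sum:
  assumes "p \<ge> 2" "t \<le> digit_sum p n"
  shows "\<exists>s. bottom_segment p n s \<and> digit_sum p s = t"
proof -
  have "\<exists>j m. m \<le> digit p n j \<and> t = digit_sum p (n mod p ^ j) + m"
    if "t \<le> digit_sum p (n mod p ^ J)" for J
    using that
  proof (induction J)
    case 0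
    then show ?case by (intro exI[of _ 0]) simp
  next
    case (Suc J)
    show ?case
    proof (cases "t \<le> digit_sum p (n mod p ^ J)")
      case False
      have "n mod p ^ Suc J = n mod p ^ J + digit p n J * p ^ J"
        using sum_digits_eq_mod[of p n "Suc J"] sum_digits_eq_mod[of p n J] by simp
      then have "t \<le> digit_sum p (n mod p ^ J) + digit p n J"
        using Suc.prems digit_sum_bottom_segment[OF assms(1), of "digit p n J" n J] by simp
      then show ?thesis
        using False by (intro exI[of _ J] exI[of _ "t - digit_sum p (n mod p ^ J)"]) simp
    qed (rule Suc.IH)
  qed
  from this[of n] obtain j m where "m \<le> digit p n j" "t = digit_sum p (n mod p ^ j) + m"
    using assms by (auto simp: power_gt_expt)
  then show ?thesis
    using digit_sum_bottom_segment[OF assms(1)] by (auto simp: bottom_segment_iff)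
qed

lemma bottom_segment_le:
  assumes "bottom_segment p n s"
  shows "s \<le> n"
proof -
  obtain j m where m: "m \<le> digit p n j" and s: "s = n mod p ^ j + m * p ^ j"
    using assms by (auto simp: bottom_segment_iff)
  have "m \<le> n div p ^ j" using m by (simp add: digit_def) (meson mod_less_eq_dividend le_trans)
  then have "m * p ^ j \<le> n div p ^ j * p ^ j" by (rule mult_le_mono1)
  then show ?thesis using s mod_div_mult_eq[of n "p ^ j"] by linarith
qed

(* Subtracting k from n borrows nothing across the digit position that cuts n into s and n - s. *)
lemma digit_sum_diff_bottom_segment:
  assumes "p \<ge> 2" "bottom_segment p n s" "k \<le> s"
  shows "digit_sum p (n - k) = digit_sum p (n - s) + digit_sum p (s - k)"
proof -
  obtain j m where m: "m \<le> digit p n j" and s: "s = n mod p ^ j + m * p ^ j"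
    using assms by (auto simp: bottom_segment_iff)
  define d where "d = digit p n j"
  define q where "q = n div p ^ j div p"
  define a b where "a = (s - k) mod p ^ j" and "b = (s - k) div p ^ j"
  have d: "m \<le> d" "d < p" using m digit_less[of p n j] assms(1) by (auto simp: d_def)
  have pj: "p ^ j > 0" using assms(1) by simp
  have "n div p ^ j = d + p * q" by (simp add: d_def q_def digit_def)
  then have n: "n = n mod p ^ j + p ^ j * (d + p * q)"
    using mod_mult_div_eq[of n "p ^ j"] by simp
  \<comment> \<open>Since b \<le> m, the sum d - m + b is at most d < p, hence a single digit
    without carry.\<close>
  have "b \<le> s div p ^ j" unfolding b_def by (intro div_le_mono) simp
  also have "s div p ^ j = m" using pj by (simp add: s)
  finally have b: "b \<le> m" .
  have sk: "s - k = a + p ^ j * b" by (simp add: a_def b_def)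
  have a: "a < p ^ j" using pj by (simp add: a_def)
  have "p ^ j * (d + p * q) = p ^ j * m + p ^ j * ((d - m) + p * q)"
    using d(1) by (simp flip: add_mult_distrib2)
  then have ns: "n - s = 0 + p ^ j * ((d - m) + p * q)"
    using n s by (simp add: mult.commute)
  have "n - k = (n - s) + (s - k)"
    using assms(3) bottom_segment_le[OF assms(2)] by simp
  also have "\<dots> = a + p ^ j * ((d - m + b) + p * q)"
    unfolding ns sk by (simp add: add_mult_distrib2)
  finally have nk: "n - k = a + p ^ j * ((d - m + b) + p * q)" .
  have "digit_sum p (n - k) = digit_sum p a + (d - m + b + digit_sum p q)"
    unfolding nk using digit_sum_split[OF a assms(1)] digit_sum_step[of "d - m + b" p q] d b assms(1) by simp
  moreover have "digit_sum p (n - s) = d - m + digit_sum p q"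
    unfolding ns using digit_sum_split[OF pj assms(1)] digit_sum_step[of "d - m" p q] d assms(1) by simp
  moreover have "digit_sum p (s - k) = digit_sum p a + b"
    unfolding sk using digit_sum_split[OF a assms(1)] digit_sum_less[of b p] d b assms(1) by simp
  ultimately show ?thesis by simp
qed

text \<open>The h trailing zeros of n force the cut to position j \<ge> h. At j = h the segment is m
  p^h with digit sum m; beyond, it contains all of c_0 p^h. Hence k \<le> n' in the theorem.\<close>

lemma bottom_segment_properties:
  assumes "p \<ge> 2" "n = c * p ^ h" "bottom_segment p n s" "digit_sum p s > 0"
  shows "p ^ h dvd s" "min (digit p c 0) (digit_sum p s) * p ^ h \<le> s"
proof -
  obtain j m where m: "m \<le> digit p n j" and s: "s = n mod p ^ j + m * p ^ j"
    using assms by (auto simp: bottom_segment_iff)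
  have "h \<le> j"
  proof (rule ccontr)
    assume "\<not> h \<le> j"
    then obtain i where "h = j + Suc i" by (metis less_imp_Suc_add not_le add_Suc_right)
    then have "n = p ^ j * (p * (c * p ^ i))" using assms(2) by (simp add: power_add ac_simps)
    then have "n mod p ^ j = 0" "digit p n j = 0" using assms(1) by (simp_all add: digit_def)
    then show False using m s assms(4) by simp
  qed
  have "p ^ h dvd n mod p ^ j"
    using assms(2) \<open>h \<le> j\<close> by (intro dvd_mod) (auto intro: le_imp_power_dvd)
  moreover have "p ^ h dvd m * p ^ j"
    using \<open>h \<le> j\<close> by (intro dvd_mult le_imp_power_dvd)
  ultimately show "p ^ h dvd s" unfolding s by (rule dvd_add)
  show "min (digit p c 0) (digit_sum p s) * p ^ h \<le> s"
  proof (cases "j = h")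
    case True
    then have "n mod p ^ j = 0" using assms(2) by simp
    then have "s = digit_sum p s * p ^ h"
      using digit_sum_bottom_segment[OF assms(1) m] s True by simp
    then show ?thesis by (metis min.cobounded2 mult_le_mono1)
  next
    case False
    then have "Suc h \<le> j" using \<open>h \<le> j\<close> by simp
    then have "p ^ Suc h dvd p ^ j" by (rule le_imp_power_dvd)
    then have "n mod p ^ j mod p ^ Suc h = n mod p ^ Suc h" by (rule mod_mod_cancel)
    moreover have "n mod p ^ Suc h = digit p c 0 * p ^ h"
      by (simp add: assms(2) digit_def mult_mod_left)
    ultimately have "digit p c 0 * p ^ h \<le> n mod p ^ j"
      by (metis mod_less_eq_dividend)
    moreover have "min (digit p c 0) (digit_sum p s) * p ^ h \<le> digit p c 0 * p ^ h"
      by (intro mult_le_mono1) simp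
    ultimately show ?thesis using s by linarith
  qed
qed

theorem theorem3p10:
  fixes p c h n k k' :: nat
  assumes "prime p"
    and "c \<ge> 1"
    and "n = c * p ^ h"
    and "1 \<le> k'" and "k' \<le> p - 1" and "[k = k'] (mod (p - 1))"
    and "0 < k" and "k \<le> min (digit p c 0) k' * p ^ h"
  shows "(k' \<le> digit_sum p n \<longrightarrow>
            (let n' = (LEAST s. bottom_segment p n s \<and> digit_sum p s = k') in
              real_of_int (maximum_pole p (bernoulli_poly_ho (- int k) (n - k))) =
                real (digit_sum p (n' - k)) / real (p - 1)) \<and>
            real_of_int (amz_estimate p n k) = (real (digit_sum p k) - real k') / real (p - 1) \<and>
            real (multiplicity p (Stirling n k)) \<ge> (real (digit_sum p k) - real k') / real (p - 1))
       \<and> ([n = k] (mod (p - 1)) \<longrightarrow>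
            AMZC p n k \<and>
            real (multiplicity p (Stirling n k)) = (real (digit_sum p k) - real k') / real (p - 1))"
proof -
  have p: "p \<ge> 2" using assms(1) by (rule prime_ge_2_nat)
  have n: "n > 0" and hn: "p ^ h dvd n" using assms(2,3) p by simp_all
  have kk': "k \<le> k' * p ^ h"
    using assms(8) by (meson le_trans min.cobounded2 mult_le_mono1)
  have kn: "k \<le> n"
  proof -
    have "min (digit p c 0) k' \<le> c" by (simp add: digit_def min.coboundedI1)
    then show ?thesis using assms(3,8) by (meson le_trans mult_le_mono1)
  qed
  obtain N where N: "k = N * (p - 1) + k'"
    using cong_residue_decomp[OF assms(7,4,5,6)] .
  have mult_fact: "multiplicity p (a * (fact k * Stirling j k)) =
      multiplicity p (fact k :: nat) + multiplicity p (a * Stirling j k)" if "a > 0" "k \<le> j" for a j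
    using that assms(1) Stirling_pos[OF assms(7) that(2)]
    by (simp add: prime_elem_multiplicity_mult_distrib)
  have legendre: "(p - 1) * multiplicity p (fact k :: nat) + digit_sum p k = k"
    by (rule legendre_digit_sum[OF assms(1)])

  \<comment> \<open>Stated for a general s since it serves n' in part (a) and n in part (b).
    Legendre's formula removes k!.\<close>
  have exact: "real (multiplicity p (Stirling s k)) = (real (digit_sum p k) - real k') / real (p - 1)
      \<and> multiplicity p (fact k :: nat) + multiplicity p (Stirling s k) = N"
    if s: "p ^ h dvd s" "k \<le> s" "[s = k'] (mod (p - 1))" for s
  proof -
    have "multiplicity p (fact k * Stirling s k) = N"
      using s assms(7) by (intro multiplicity_fact_Stirling[OF assms(1) s(1) _ assms(4,5) s(3) N kk']) simp
    then have "multiplicity p (fact k :: nat) + multiplicity p (Stirling s k) = N"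
      using mult_fact[of 1 s] s(2) by simp
    moreover from this have "(p - 1) * multiplicity p (Stirling s k) + k' = digit_sum p k"
    proof -
      have "(p - 1) * multiplicity p (fact k :: nat) + (p - 1) * multiplicity p (Stirling s k) = (p - 1) * N"
        using \<open>multiplicity p (fact k) + multiplicity p (Stirling s k) = N\<close>
        by (simp only: add_mult_distrib2[symmetric])
      then show ?thesis using legendre N by (simp add: mult.commute)
    qed
    then have "real (p - 1) * real (multiplicity p (Stirling s k)) + real k' = real (digit_sum p k)"
      by (simp only: of_nat_add[symmetric] of_nat_mult[symmetric])
    then have "real (multiplicity p (Stirling s k)) = (real (digit_sum p k) - real k') / real (p - 1)"
      using p by (simp add: eq_divide_eq mult.commute)
    ultimately show ?thesis by blast
  qed

  have lower: "N \<le> multiplicity p (fact k :: nat) + multiplicity p ((n choose j) * Stirling j k)"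
    if "k \<le> j" "j \<le> n" for j
  proof -
    have pos: "n choose j > 0" using that by (simp add: zero_less_binomial)
    have "p ^ N dvd (n choose j) * (fact k * Stirling j k)"
      by (rule binomial_Stirling_dvd[OF assms(1) hn assms(4,5) N kk'])
    then have "N \<le> multiplicity p ((n choose j) * (fact k * Stirling j k))"
      using assms(1) pos Stirling_pos[OF assms(7) that(1)] not_prime_unit[of p]
      by (intro multiplicity_geI) auto
    then show ?thesis using mult_fact[OF pos that(1)] by simp
  qed

  have a: "real_of_int (maximum_pole p (bernoulli_poly_ho (- int k) (n - k))) =
        real (digit_sum p ((LEAST s. bottom_segment p n s \<and> digit_sum p s = k') - k)) / real (p - 1)
      \<and> real_of_int (amz_estimate p n k) = (real (digit_sum p k) - real k') / real (p - 1)
      \<and> real (multiplicity p (Stirling n k)) \<ge> (real (digit_sum p k) - real k') / real (p - 1)"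
    if le: "k' \<le> digit_sum p n"
  proof -
    define n' where "n' = (LEAST s. bottom_segment p n s \<and> digit_sum p s = k')"
    have n': "bottom_segment p n n'" "digit_sum p n' = k'"
      using LeastI_ex[OF ex_bottom_segment_digit_sum[OF p le]] by (auto simp: n'_def)
    have hn': "p ^ h dvd n'" and kn': "k \<le> n'"
      using bottom_segment_properties[OF p assms(3) n'(1)] n'(2) assms(4,8) by auto
    have n'n: "n' \<le> n" using n'(1) by (rule bottom_segment_le)
    have "[n' = k'] (mod (p - 1))"
      using digit_sum_cong[OF p, of n'] n'(2) by (simp add: cong_sym)
    note ex = exact[OF hn' kn' this]
    define e where "e = multiplicity p (Stirling n' k)"
    \<comment> \<open>n' and n - n' add without carry, so Kummer's theorem gives valuation 0 for
      C(n,n').\<close>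
    have "digit_sum p n = digit_sum p (n - n') + k'"
      using digit_sum_diff_bottom_segment[OF p n'(1), of 0] n'(2) by simp
    then have "multiplicity p (n choose n') = 0"
      using multiplicity_binomial_digit_sum[OF assms(1) n'n] n'(2) p by simp
    then have attained: "multiplicity p ((n choose n') * Stirling n' k) = e"
      using assms(1) n'n Stirling_pos[OF assms(7) kn']
      by (simp add: prime_elem_multiplicity_mult_distrib zero_less_binomial e_def)
    have least: "e \<le> multiplicity p ((n choose j) * Stirling j k)" if "k \<le> j" "j \<le> n" for j
      using lower[OF that] ex by (simp add: e_def)
    have M: "maximum_pole p (bernoulli_poly_ho (- int k) (n - k)) =
        int (multiplicity p (n choose k)) - int e"
      by (rule maximum_pole_bernoulli_poly_ho[OF assms(1,7) kn least kn' n'n attained])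
    have e: "real e = (real (digit_sum p k) - real k') / real (p - 1)"
      using ex by (simp add: e_def)
    \<comment> \<open>Kummer's theorem for C(n,k); the digit sum of n - n' occurs on both sides and
      cancels.\<close>
    have "(p - 1) * multiplicity p (n choose k) + k' = digit_sum p k + digit_sum p (n' - k)"
      using multiplicity_binomial_digit_sum[OF assms(1) kn] n'
        digit_sum_diff_bottom_segment[OF p n'(1) kn'] \<open>digit_sum p n = _\<close> by simp
    then have "real (p - 1) * real (multiplicity p (n choose k)) + real k' =
        real (digit_sum p k) + real (digit_sum p (n' - k))"
      by (simp only: of_nat_add[symmetric] of_nat_mult[symmetric])
    then have "real (multiplicity p (n choose k)) - real e = real (digit_sum p (n' - k)) / real (p - 1)"
      unfolding e using p by (simp add: field_simps)
    moreover have "real e \<le> real (multiplicity p (Stirling n k))"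
      using least[OF kn order_refl] by simp
    ultimately show ?thesis
      using e by (simp add: M amz_estimate_def n'_def)
  qed
  have b: "AMZC p n k \<and>
      real (multiplicity p (Stirling n k)) = (real (digit_sum p k) - real k') / real (p - 1)"
    if "[n = k] (mod (p - 1))"
  proof -
    have nk': "[n = k'] (mod (p - 1))" using that assms(6) by (rule cong_trans)
    \<comment> \<open>A positive digit sum in the class of k' is at least k', so part (a)
      applies.\<close>
    then have "[digit_sum p n = k'] (mod (p - 1))"
      using digit_sum_cong[OF p, of n] by (rule cong_trans[rotated])
    then obtain q where "digit_sum p n = q * (p - 1) + k'"
      using cong_residue_decomp[OF digit_sum_pos[OF p n] assms(4,5)] by blast
    then have "k' \<le> digit_sum p n" by simp
    note a[OF this]
    moreover note exact[OF hn kn nk']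
    ultimately have "real_of_int (int (multiplicity p (Stirling n k))) = real_of_int (amz_estimate p n k)"
      by simp
    then show ?thesis using exact[OF hn kn nk'] by (simp only: AMZC_def of_int_eq_iff)
  qed
  show ?thesis unfolding Let_def by (intro conjI impI) (simp_all only: a b)
qed

end
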